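(* Let $q$ be an odd prime power, $n\geq 1$ and $k\geq 2$ integers, and $\mathcal{B}$ a non-degenerate symmetric bilinear form on $\mathbb{F}_q^n$. Suppose $S\subset\mathbb{F}_q^n\setminus\{\bm{0}\}$ is $(k,2)$-orthogonal with respect to $\mathcal{B}$. Then \[ |S|\leq \left(k-1+\frac{(k-1)^2}{q-k+1}\right)\left(q^{n/2}+1\right). \]
   Context: A bilinear form on $\mathbb{F}_q^n$ is $\mathcal{B}(\bm{x},\bm{y})=\bm{x}^TA\bm{y}$ for an $n\times n$ matrix $A$ over $\mathbb{F}_q$; symmetric means $A$ symmetric and non-degenerate means $\det A\neq 0$. Two nonzero vectors are mutually orthogonal if $\mathcal{B}(\bm{v}_1,\bm{v}_2)=0$. A set $S\subset\mathbb{F}_q^n\setminus\{\bm{0}\}$ is $(k,2)$-orthogonal if among any $k$ distinct vectors of $S$ at least two are mutually orthogonal.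
   Formalization: The formal statement adds the hypothesis k ≤ q: for k = q+1 the denominator q−k+1 is zero, and for k > q+1 the right-hand side is negative, so the bound fails for every S, even the empty set. *)

theory Defs
  imports "HOL-Analysis.Analysis"
begin

definition matrix_form :: "'a::field^'n^'n \<Rightarrow> 'a^'n \<Rightarrow> 'a^'n \<Rightarrow> 'a" where
  "matrix_form A x y = scalar_product x (A *v y)"

definition symmetric_matrix :: "'a^'n^'n \<Rightarrow> bool" where
  "symmetric_matrix A \<longleftrightarrow> transpose A = A"

definition nondegenerate_matrix :: "'a::field^'n^'n \<Rightarrow> bool" where
  "nondegenerate_matrix A \<longleftrightarrow> det A \<noteq> 0"

definition mutually_orthogonal ::
  "('a::field^'n \<Rightarrow> 'a^'n \<Rightarrow> 'a) \<Rightarrow> 'a^'n \<Rightarrow> 'a^'n \<Rightarrow> bool" where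
  "mutually_orthogonal B v w \<longleftrightarrow> v \<noteq> 0 \<and> w \<noteq> 0 \<and> B v w = 0"

text \<open>The two orthogonal vectors must be distinct: a single isotropic vector does not count
  as an orthogonal pair.\<close>

definition k2_orthogonal ::
  "('a::field^'n \<Rightarrow> 'a^'n \<Rightarrow> 'a) \<Rightarrow> nat \<Rightarrow> ('a^'n) set \<Rightarrow> bool" where
  "k2_orthogonal B k S \<longleftrightarrow> S \<subseteq> UNIV - {0} \<and>
     (\<forall>T\<subseteq>S. finite T \<and> card T = k \<longrightarrow>
        (\<exists>v\<in>T. \<exists>w\<in>T. v \<noteq> w \<and> mutually_orthogonal B v w))"

end

theory Submission
  imports Defs
begin

text \<open>Let \<open>N\<close> be the number of ordered pairs \<open>(x, y)\<close> in \<open>S \<times> S\<close> with \<open>B x y = 0\<close>. The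
  non-orthogonality graph on \<open>S\<close> has no \<open>k\<close>-clique, so Turan's bound gives
  \<open>|S|\<^sup>2 \<le> (k - 1) (N + |S|)\<close>. On the other hand, the number \<open>d y\<close> of \<open>x \<in> S\<close> orthogonal to
  \<open>y\<close> has mean \<open>|S| / q\<close> over the whole space, and its variance is governed by the proportional
  pairs in \<open>S\<close>, of which there are at most \<open>(q - 1) |S|\<close>. Cauchy-Schwarz on \<open>S\<close> then
  gives \<open>N \<le> |S|\<^sup>2 / q + |S| q\<^bsup>n/2\<^esup> (q - 1) / q\<close>, and the two bounds combine.\<close>

section \<open>Turan's bound\<close>

text \<open>In graph terms, \<open>R\<close> is non-adjacency, made reflexive. The induction removes a maximum
  clique \<open>K\<close>: every vertex outside \<open>K\<close> is non-adjacent to some vertex of \<open>K\<close>.\<close>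

lemma turan_bound:
  fixes R :: "'v \<Rightarrow> 'v \<Rightarrow> bool"
  assumes "finite S"
    and sym: "\<And>x y. R x y \<Longrightarrow> R y x" and refl: "\<And>x. R x x"
    and "\<And>T. T \<subseteq> S \<Longrightarrow> pairwise (\<lambda>x y. \<not> R x y) T \<Longrightarrow> card T \<le> r"
  shows "(card S)\<^sup>2 \<le> r * card {(x, y) \<in> S \<times> S. R x y}"
  using assms(1,4)
proof (induction S rule: finite_psubset_induct)
  case (psubset S)
  define C where "C = {T. T \<subseteq> S \<and> pairwise (\<lambda>x y. \<not> R x y) T}"
  have finC: "finite C"
    by (rule finite_subset[of _ "Pow S"]) (auto simp: C_def psubset.hyps)
  show ?case
  proof (cases "S = {}")
    case True
    then show ?thesis by simp
  next
    case False
    then obtain a where a: "a \<in> S" by blast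
    have C1: "{a} \<in> C" using a by (simp add: C_def)
    then have "Max (card ` C) \<in> card ` C"
      by (intro Max_in) (use finC in auto)
    then obtain K where K: "K \<in> C" and cK: "card K = Max (card ` C)" by auto
    have Kmax: "card T \<le> card K" if "T \<in> C" for T
      using that finC cK by simp
    define m where "m = card K"
    have KS: "K \<subseteq> S" and Kp: "pairwise (\<lambda>x y. \<not> R x y) K" using K by (auto simp: C_def)
    have finK: "finite K" using KS psubset.hyps finite_subset by blast
    \<comment> \<open>The singleton clique makes \<open>K\<close> nonempty, so that
      \<open>S - K\<close> is a proper subset and the induction hypothesis applies.\<close>
    have "m \<ge> 1" using Kmax[OF C1] by (simp add: m_def)
    have "m \<le> r" using psubset.prems[OF KS Kp] by (simp add: m_def)
    have ex: "\<exists>y\<in>K. R x y" if "x \<in> S - K" for x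
    proof (rule ccontr)
      assume "\<not> (\<exists>y\<in>K. R x y)"
      then have "insert x K \<in> C"
        using that KS Kp sym by (auto simp: C_def pairwise_insert)
      from Kmax[OF this] that finK show False by simp
    qed
    then obtain g where g: "\<And>x. x \<in> S - K \<Longrightarrow> g x \<in> K \<and> R x (g x)" by metis
    \<comment> \<open>The four families lie in different blocks of the splitting of
      \<open>S \<times> S\<close> by \<open>K\<close>, hence are disjoint. Each vertex outside
      \<open>K\<close> contributes one pair with \<open>K\<close> in either order, and each vertex
      of \<open>K\<close> its diagonal pair.\<close>
    define D where "D = {(x, y) \<in> (S - K) \<times> (S - K). R x y}"
    define E1 where "E1 = (\<lambda>x. (x, g x)) ` (S - K)"
    define E2 where "E2 = (\<lambda>x. (g x, x)) ` (S - K)"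
    define E3 where "E3 = (\<lambda>x. (x, x)) ` K"
    have finSK: "finite (S - K)" using psubset.hyps by simp
    have finD: "finite D"
      by (rule finite_subset[of _ "(S - K) \<times> (S - K)"]) (auto simp: D_def psubset.hyps)
    have c: "card E1 = card (S - K)" "card E2 = card (S - K)" "card E3 = m"
      unfolding E1_def E2_def E3_def m_def by (auto intro!: card_image inj_onI)
    have "card D + card E1 + card E2 + card E3 = card (D \<union> E1 \<union> E2 \<union> E3)"
      apply (subst card_Un_disjoint)
      subgoal using finD finSK by (simp add: E1_def E2_def)
      subgoal using finK by (simp add: E3_def)
      subgoal using g by (auto simp: D_def E1_def E2_def E3_def)
      apply (subst card_Un_disjoint)
      subgoal using finD finSK by (simp add: E1_def)
      subgoal using finSK by (simp add: E2_def)
      subgoal using g by (auto simp: D_def E1_def E2_def)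
      apply (subst card_Un_disjoint)
      subgoal using finD by simp
      subgoal using finSK by (simp add: E1_def)
      subgoal using g by (auto simp: D_def E1_def)
      apply simp
      done
    also have "\<dots> \<le> card {(x, y) \<in> S \<times> S. R x y}"
    proof (rule card_mono)
      show "finite {(x, y) \<in> S \<times> S. R x y}"
        by (rule finite_subset[of _ "S \<times> S"]) (auto simp: psubset.hyps)
      show "D \<union> E1 \<union> E2 \<union> E3 \<subseteq> {(x, y) \<in> S \<times> S. R x y}"
        using g KS refl sym by (auto simp: D_def E1_def E2_def E3_def)
    qed
    finally have le: "card D + 2 * card (S - K) + m \<le> card {(x, y) \<in> S \<times> S. R x y}"
      using c by simp
    have "K \<noteq> {}" using \<open>m \<ge> 1\<close> by (auto simp: m_def)
    then have sub: "S - K \<subset> S" using KS by blast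
    have IH: "(card (S - K))\<^sup>2 \<le> r * card D"
      unfolding D_def by (rule psubset.IH[OF sub]) (use psubset.prems in blast)
    have cS: "card S = card (S - K) + m"
      using card_Diff_subset[OF finK KS] card_mono[OF psubset.hyps KS] by (simp add: m_def)
    have "(card S)\<^sup>2 = (card (S - K))\<^sup>2 + m * (2 * card (S - K) + m)"
      unfolding cS by (simp add: power2_eq_square algebra_simps)
    also have "\<dots> \<le> r * card D + r * (2 * card (S - K) + m)"
      using IH \<open>m \<le> r\<close> by (intro add_mono mult_right_mono) auto
    also have "\<dots> = r * (card D + 2 * card (S - K) + m)" by (simp add: algebra_simps)
    also have "\<dots> \<le> r * card {(x, y) \<in> S \<times> S. R x y}" using le by simp
    finally show ?thesis .
  qed
qed

section \<open>Counting orthogonal vectors\<close>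

text \<open>Every fibre of \<open>\<phi>\<close> is a translate of the kernel, so all fibres have
  the same size, and surjectivity gives one for each element of the target.\<close>

lemma card_kernel:
  fixes \<phi> :: "'v::{ab_group_add,finite} \<Rightarrow> 'w::{ab_group_add,finite}"
  assumes add: "\<And>x y. \<phi> (x + y) = \<phi> x + \<phi> y" and "surj \<phi>"
  shows "CARD('v) = CARD('w) * card {y. \<phi> y = 0}"
proof -
  have fib: "card {y. \<phi> y = w} = card {y. \<phi> y = 0}" for w
  proof -
    obtain z where z: "\<phi> z = w" using \<open>surj \<phi>\<close> by (metis surjD)
    have "(+) z ` {y. \<phi> y = 0} = {y. \<phi> y = w}"
    proof (intro equalityI subsetI)
      fix y assume "y \<in> {y. \<phi> y = w}"
      then have "\<phi> (y - z) = 0" using add[of "y - z" z] z by simp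
      then show "y \<in> (+) z ` {y. \<phi> y = 0}" by (intro image_eqI[of _ _ "y - z"]) auto
    qed (auto simp: add z)
    moreover have "card ((+) z ` {y. \<phi> y = 0}) = card {y. \<phi> y = 0}"
      by (intro card_image) simp
    ultimately show ?thesis by simp
  qed
  have "(\<Union>w. {y. \<phi> y = w}) = UNIV" by auto
  then have "CARD('v) = card (\<Union>w. {y. \<phi> y = w})" by simp
  also have "\<dots> = (\<Sum>w\<in>UNIV. card {y. \<phi> y = w})"
    by (rule card_UN_disjoint) auto
  also have "\<dots> = (\<Sum>w\<in>(UNIV :: 'w set). card {y. \<phi> y = 0})"
    by (intro sum.cong refl fib)
  also have "\<dots> = CARD('w) * card {y. \<phi> y = 0}" by simp
  finally show ?thesis .
qed

section \<open>The bilinear form of a matrix and its radical\<close>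

lemma matrix_form_add_right: "matrix_form A x (y + z) = matrix_form A x y + matrix_form A x z"
  by (simp add: matrix_form_def scalar_product_def matrix_vector_right_distrib
      distrib_left sum.distrib)

lemma matrix_form_scale_right: "matrix_form A x (c *s y) = c * matrix_form A x y"
  by (simp add: matrix_form_def scalar_product_def matrix_vector_mult_def sum_distrib_left
      mult_ac)

lemma matrix_form_diff_left: "matrix_form A (x - y) z = matrix_form A x z - matrix_form A y z"
  by (simp add: matrix_form_def scalar_product_def left_diff_distrib sum_subtractf)

lemma matrix_form_scale_left: "matrix_form A (c *s x) y = c * matrix_form A x y"
  by (simp add: matrix_form_def scalar_product_def sum_distrib_left mult_ac)

lemma matrix_form_commute:
  assumes "symmetric_matrix A"
  shows "matrix_form A x y = matrix_form A y x"
proof -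
  have A: "A $ i $ j = A $ j $ i" for i j
  proof -
    have "A $ i $ j = transpose A $ i $ j" using assms by (simp add: symmetric_matrix_def)
    then show ?thesis by (simp add: transpose_def)
  qed
  have "matrix_form A x y = (\<Sum>i\<in>UNIV. \<Sum>j\<in>UNIV. x $ i * A $ i $ j * y $ j)"
    by (simp add: matrix_form_def scalar_product_def matrix_vector_mult_def sum_distrib_left
        mult_ac)
  also have "\<dots> = (\<Sum>j\<in>UNIV. \<Sum>i\<in>UNIV. x $ i * A $ i $ j * y $ j)" by (rule sum.swap)
  also have "\<dots> = (\<Sum>j\<in>UNIV. \<Sum>i\<in>UNIV. x $ i * A $ j $ i * y $ j)"
    by (intro sum.cong refl) (simp only: A)
  also have "\<dots> = matrix_form A y x"
    by (simp add: matrix_form_def scalar_product_def matrix_vector_mult_def sum_distrib_left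
        mult_ac)
  finally show ?thesis .
qed

text \<open>A right inverse of \<open>A\<close> makes each unit vector some \<open>A *v y\<close>,
  and pairing \<open>x\<close> with that \<open>y\<close> reads off a coordinate of
  \<open>x\<close>.\<close>

lemma matrix_form_left_radical:
  assumes "nondegenerate_matrix A" and "\<And>y. matrix_form A x y = 0"
  shows "x = 0"
proof -
  obtain A' where A': "A ** A' = mat 1"
    using assms(1) by (auto simp: nondegenerate_matrix_def invertible_det_nz[symmetric] invertible_def)
  have "x $ i = 0" for i
  proof -
    have "A *v (A' *v axis i 1) = axis i 1"
      by (simp add: matrix_vector_mul_assoc A')
    then have "matrix_form A x (A' *v axis i 1) = (\<Sum>j\<in>UNIV. x $ j * axis i 1 $ j)"
      by (simp add: matrix_form_def scalar_product_def)
    also have "\<dots> = x $ i" by (simp add: axis_def if_distrib cong: if_cong)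
    finally show ?thesis using assms(2) by simp
  qed
  then show ?thesis by (simp add: vec_eq_iff)
qed

lemma matrix_form_eq_one:
  assumes "nondegenerate_matrix A" and "x \<noteq> 0"
  obtains y where "matrix_form A x y = 1"
proof -
  obtain y where "matrix_form A x y \<noteq> 0" using matrix_form_left_radical assms by blast
  then have "matrix_form A x (inverse (matrix_form A x y) *s y) = 1"
    by (simp add: matrix_form_scale_right)
  then show thesis by (rule that)
qed

text \<open>Otherwise the functional of \<open>x\<close> vanishes on the kernel of that of
  \<open>x'\<close> and is a multiple of it; non-degeneracy carries the proportionality over to the
  vectors themselves.\<close>

lemma matrix_form_separate:
  assumes "nondegenerate_matrix A" and "x' \<noteq> 0" and np: "\<And>c. x \<noteq> c *s x'"
  obtains y where "matrix_form A x y = 1" "matrix_form A x' y = 0"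
proof -
  have "\<exists>y. matrix_form A x' y = 0 \<and> matrix_form A x y \<noteq> 0"
  proof (rule ccontr)
    assume "\<not> ?thesis"
    then have van: "matrix_form A x y = 0" if "matrix_form A x' y = 0" for y using that by blast
    obtain y0 where y0: "matrix_form A x' y0 = 1" using matrix_form_eq_one assms by blast
    have "matrix_form A (x - matrix_form A x y0 *s x') y = 0" for y
    proof -
      \<comment> \<open>The projection of \<open>y\<close> along \<open>y0\<close> onto the vectors
        orthogonal to \<open>x'\<close>.\<close>
      define z where "z = y + (- matrix_form A x' y) *s y0"
      have "matrix_form A x' z = 0"
        unfolding z_def matrix_form_add_right matrix_form_scale_right y0 by simp
      then have "matrix_form A x z = 0" by (rule van)
      then show ?thesis
        unfolding z_def matrix_form_add_right matrix_form_scale_right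
          matrix_form_diff_left matrix_form_scale_left by (simp add: mult.commute)
    qed
    from matrix_form_left_radical[OF assms(1) this] np show False by simp
  qed
  then obtain y where y: "matrix_form A x' y = 0" "matrix_form A x y \<noteq> 0" by blast
  show thesis
    by (rule that[of "inverse (matrix_form A x y) *s y"]) (simp_all add: matrix_form_scale_right y)
qed

section \<open>Sizes of orthogonal complements\<close>

lemma card_orthogonal:
  fixes A :: "'a::{field,finite}^'n^'n"
  assumes "nondegenerate_matrix A" and "x \<noteq> 0"
  shows "CARD('a^'n) = CARD('a) * card {y. matrix_form A x y = 0}"
proof (rule card_kernel[OF matrix_form_add_right])
  obtain y where "matrix_form A x y = 1" using matrix_form_eq_one assms by blast
  then have "matrix_form A x (c *s y) = c" for c by (simp add: matrix_form_scale_right)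
  then show "surj (matrix_form A x)" by (rule surjI)
qed

lemma card_orthogonal_pair:
  fixes A :: "'a::{field,finite}^'n^'n"
  assumes nd: "nondegenerate_matrix A" and "x \<noteq> 0" "x' \<noteq> 0" and np: "\<And>c. x' \<noteq> c *s x"
  shows "CARD('a^'n) = (CARD('a))\<^sup>2 * card {y. matrix_form A x y = 0 \<and> matrix_form A x' y = 0}"
proof -
  \<comment> \<open>Separating in both orders needs non-proportionality in both directions. The
    resulting \<open>y1\<close> and \<open>y2\<close> are dual to \<open>x\<close> and
    \<open>x'\<close>, which makes \<open>\<phi>\<close> below surjective.\<close>
  have np': "x \<noteq> c *s x'" for c
  proof
    assume x: "x = c *s x'"
    with \<open>x \<noteq> 0\<close> have "c \<noteq> 0" by auto
    with x have "x' = inverse c *s x" by (simp add: vector_smult_assoc)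
    with np show False by blast
  qed
  obtain y1 where y1: "matrix_form A x y1 = 1" "matrix_form A x' y1 = 0"
    using matrix_form_separate[OF nd \<open>x' \<noteq> 0\<close> np'] .
  obtain y2 where y2: "matrix_form A x' y2 = 1" "matrix_form A x y2 = 0"
    using matrix_form_separate[OF nd \<open>x \<noteq> 0\<close> np] .
  define \<phi> where "\<phi> y = (matrix_form A x y, matrix_form A x' y)" for y
  have "\<phi> (fst p *s y1 + snd p *s y2) = p" for p
    by (simp add: \<phi>_def matrix_form_add_right matrix_form_scale_right y1 y2)
  then have "surj \<phi>" by (rule surjI)
  then have "CARD('a^'n) = CARD('a \<times> 'a) * card {y. \<phi> y = 0}"
    by (intro card_kernel) (simp_all add: \<phi>_def matrix_form_add_right)
  then show ?thesis by (simp add: \<phi>_def zero_prod_def power2_eq_square)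
qed

text \<open>Since \<open>0 \<notin> S\<close>, the scalar 0 yields no element of \<open>S\<close>;
  this accounts for the subtracted 1.\<close>

lemma card_proportional_le:
  fixes x :: "'a::{field,finite}^'n"
  assumes "0 \<notin> S"
  shows "card {x' \<in> S. \<exists>c. x' = c *s x} \<le> CARD('a) - 1"
proof -
  have "{x' \<in> S. \<exists>c. x' = c *s x} \<subseteq> (\<lambda>c. c *s x) ` (UNIV - {0})" using assms by auto
  then have "card {x' \<in> S. \<exists>c. x' = c *s x} \<le> card ((UNIV :: 'a set) - {0})"
    by (rule surj_card_le[rotated]) simp
  then show ?thesis by simp
qed

section \<open>The mixing bound\<close>

text \<open>The second moment of \<open>d\<close> counts the common orthogonal vectors of pairs in
  \<open>S\<close>. The share of independent pairs cancels against the mean; what remains is the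
  excess of at most \<open>Q - 1\<close> proportional partners for each vector.\<close>

lemma orthogonal_degree_variance:
  fixes A :: "'a::{field,finite}^'n^'n"
  assumes nd: "nondegenerate_matrix A" and S0: "0 \<notin> S"
  defines "Q \<equiv> real CARD('a)" and "V \<equiv> real CARD('a^'n)" and "s \<equiv> real (card S)"
    and "d \<equiv> \<lambda>y. real (card {x \<in> S. matrix_form A x y = 0})"
  shows "(\<Sum>y\<in>UNIV. (d y - s / Q)\<^sup>2) \<le> s * V * (Q - 1)\<^sup>2 / Q\<^sup>2"
proof -
  have Q: "Q \<ge> 1" unfolding Q_def using zero_less_card_finite[where 'a='a] by linarith
  have V: "V \<ge> 0" by (simp add: V_def)
  define I where "I x y = (of_bool (matrix_form A x y = 0) :: real)" for x y
  have d: "d y = (\<Sum>x\<in>S. I x y)" for y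
    by (simp add: d_def I_def of_bool_def sum.If_cases Int_def)
  have I1: "(\<Sum>y\<in>UNIV. I x y) = V / Q" if "x \<in> S" for x
  proof -
    have "x \<noteq> 0" using that S0 by auto
    from arg_cong[OF card_orthogonal[OF nd this], of real]
    have "V = Q * (\<Sum>y\<in>UNIV. I x y)"
      by (simp add: V_def Q_def I_def of_bool_def sum.If_cases)
    then show ?thesis using Q by simp
  qed
  \<comment> \<open>Independent vectors give exactly \<open>V / Q\<^sup>2\<close>. A proportional
    pair, including \<open>x' = x\<close>, gives at most \<open>V / Q\<close>, and the
    \<open>of_bool\<close> term records the difference.\<close>
  have I2: "(\<Sum>y\<in>UNIV. I x y * I x' y)
      \<le> V / Q\<^sup>2 + of_bool (\<exists>c. x' = c *s x) * (V / Q - V / Q\<^sup>2)"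
    if "x \<in> S" "x' \<in> S" for x x'
  proof (cases "\<exists>c. x' = c *s x")
    case True
    have "(\<Sum>y\<in>UNIV. I x y * I x' y) \<le> (\<Sum>y\<in>UNIV. I x y)"
      by (intro sum_mono) (simp add: I_def)
    with True I1[OF that(1)] show ?thesis by simp
  next
    case False
    have nz: "x \<noteq> 0" "x' \<noteq> 0" using that S0 by auto
    have "CARD('a^'n) = (CARD('a))\<^sup>2 * card {y. matrix_form A x y = 0 \<and> matrix_form A x' y = 0}"
      using card_orthogonal_pair[OF nd nz] False by blast
    then have "V = Q\<^sup>2 * real (card {y. matrix_form A x y = 0 \<and> matrix_form A x' y = 0})"
      unfolding V_def Q_def by (simp only: of_nat_mult of_nat_power)
    moreover have "I x y * I x' y = (if matrix_form A x y = 0 \<and> matrix_form A x' y = 0 then 1 else 0)"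
      for y by (simp add: I_def)
    ultimately have "V = Q\<^sup>2 * (\<Sum>y\<in>UNIV. I x y * I x' y)"
      by (simp add: sum.If_cases)
    then show ?thesis using False Q by simp
  qed
  have row: "(\<Sum>x'\<in>S. \<Sum>y\<in>UNIV. I x y * I x' y) \<le> s * (V / Q\<^sup>2) + (Q - 1) * (V / Q - V / Q\<^sup>2)"
    if "x \<in> S" for x
  proof -
    have "(\<Sum>x'\<in>S. \<Sum>y\<in>UNIV. I x y * I x' y)
        \<le> (\<Sum>x'\<in>S. V / Q\<^sup>2 + of_bool (\<exists>c. x' = c *s x) * (V / Q - V / Q\<^sup>2))"
      by (intro sum_mono I2 that)
    also have "\<dots> = s * (V / Q\<^sup>2)
        + real (card {x' \<in> S. \<exists>c. x' = c *s x}) * (V / Q - V / Q\<^sup>2)"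
      by (simp add: sum.distrib s_def flip: sum_distrib_right)
         (simp add: of_bool_def sum.If_cases Int_def)
    also have "\<dots> \<le> s * (V / Q\<^sup>2) + (Q - 1) * (V / Q - V / Q\<^sup>2)"
    proof (intro add_left_mono mult_right_mono)
      show "real (card {x' \<in> S. \<exists>c. x' = c *s x}) \<le> Q - 1"
        using card_proportional_le[OF S0, of x] Q unfolding Q_def by linarith
      have "V / Q\<^sup>2 \<le> V / Q" using Q V
        by (intro divide_left_mono) (auto simp: power2_eq_square)
      then show "0 \<le> V / Q - V / Q\<^sup>2" by simp
    qed
    finally show ?thesis .
  qed
  have d1: "(\<Sum>y\<in>UNIV. d y) = s * V / Q"
  proof -
    have "(\<Sum>y\<in>UNIV. d y) = (\<Sum>x\<in>S. \<Sum>y\<in>UNIV. I x y)" unfolding d by (rule sum.swap)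
    also have "\<dots> = (\<Sum>x\<in>S. V / Q)" by (intro sum.cong refl I1)
    finally show ?thesis by (simp add: s_def)
  qed
  have "(\<Sum>y\<in>UNIV. (d y)\<^sup>2) = (\<Sum>y\<in>UNIV. \<Sum>x\<in>S. \<Sum>x'\<in>S. I x y * I x' y)"
    by (simp add: d power2_eq_square sum_product)
  also have "\<dots> = (\<Sum>x\<in>S. \<Sum>y\<in>UNIV. \<Sum>x'\<in>S. I x y * I x' y)" by (rule sum.swap)
  also have "\<dots> = (\<Sum>x\<in>S. \<Sum>x'\<in>S. \<Sum>y\<in>UNIV. I x y * I x' y)"
    by (intro sum.cong refl sum.swap)
  also have "\<dots> \<le> (\<Sum>x\<in>S. s * (V / Q\<^sup>2) + (Q - 1) * (V / Q - V / Q\<^sup>2))"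
    by (intro sum_mono row)
  also have "\<dots> = s * (s * (V / Q\<^sup>2) + (Q - 1) * (V / Q - V / Q\<^sup>2))" by (simp add: s_def)
  finally have d2: "(\<Sum>y\<in>UNIV. (d y)\<^sup>2) \<le> s * (s * (V / Q\<^sup>2) + (Q - 1) * (V / Q - V / Q\<^sup>2))" .
  have "(\<Sum>y\<in>UNIV. (d y - s / Q)\<^sup>2)
      = (\<Sum>y\<in>UNIV. (d y)\<^sup>2 - 2 * (s / Q) * d y + (s / Q)\<^sup>2)"
    by (simp add: power2_diff algebra_simps)
  also have "\<dots> = (\<Sum>y\<in>UNIV. (d y)\<^sup>2) - 2 * (s / Q) * (\<Sum>y\<in>UNIV. d y) + V * (s / Q)\<^sup>2"
    by (simp add: sum.distrib sum_subtractf V_def sum_distrib_left)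
  \<comment> \<open>The three terms in \<open>s\<^sup>2 * V / Q\<^sup>2\<close> have coefficients 1,
    -2 and 1, so they cancel.\<close>
  also have "\<dots> \<le> s * (s * (V / Q\<^sup>2) + (Q - 1) * (V / Q - V / Q\<^sup>2))
      - 2 * (s / Q) * (s * V / Q) + V * (s / Q)\<^sup>2"
    using d2 d1 by simp
  also have "\<dots> = s * V * (Q - 1)\<^sup>2 / Q\<^sup>2"
    using Q by (simp add: field_simps power2_eq_square)
  finally show ?thesis .
qed

lemma card_orthogonal_pairs_le:
  fixes A :: "'a::{field,finite}^'n^'n"
  assumes nd: "nondegenerate_matrix A" and S0: "0 \<notin> S"
  defines "Q \<equiv> real CARD('a)" and "s \<equiv> real (card S)"
  shows "real (card {(x, y) \<in> S \<times> S. matrix_form A x y = 0})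
    \<le> s\<^sup>2 / Q + s * sqrt (real CARD('a^'n)) * ((Q - 1) / Q)"
proof -
  define d where "d y = real (card {x \<in> S. matrix_form A x y = 0})" for y
  define V where "V = real CARD('a^'n)"
  have Q: "Q \<ge> 1" unfolding Q_def using zero_less_card_finite[where 'a='a] by linarith
  \<comment> \<open>Grouping the pairs by their second entry turns their number into the sum of
    \<open>d\<close> over \<open>S\<close>.\<close>
  have "{(x, y) \<in> S \<times> S. matrix_form A x y = 0} = prod.swap ` (SIGMA y:S. {x \<in> S. matrix_form A x y = 0})"
    by (auto simp: image_iff)
  then have N: "real (card {(x, y) \<in> S \<times> S. matrix_form A x y = 0}) = (\<Sum>y\<in>S. d y)"
    by (simp add: card_image card_SigmaI d_def)
  have "(\<Sum>y\<in>S. (d y - s / Q))\<^sup>2 \<le> (\<Sum>y\<in>S. (d y - s / Q)\<^sup>2) * s"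
    using Cauchy_Schwarz_ineq_sum[of "\<lambda>y. d y - s / Q" "\<lambda>_. 1" S] by (simp add: s_def)
  \<comment> \<open>The variance is controlled over the whole space only; the added squares are
    nonnegative.\<close>
  also have "\<dots> \<le> (\<Sum>y\<in>UNIV. (d y - s / Q)\<^sup>2) * s"
    by (intro mult_right_mono sum_mono2) (auto simp: s_def)
  also have "\<dots> \<le> s * V * (Q - 1)\<^sup>2 / Q\<^sup>2 * s"
    unfolding d_def s_def Q_def V_def
    by (intro mult_right_mono orthogonal_degree_variance[OF nd S0]) simp
  also have "\<dots> = (s * sqrt V * ((Q - 1) / Q))\<^sup>2"
    by (simp add: power_mult_distrib power_divide V_def power2_eq_square)
  finally have "(\<Sum>y\<in>S. (d y - s / Q)) \<le> s * sqrt V * ((Q - 1) / Q)"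
    by (rule power2_le_imp_le) (use Q in \<open>auto simp: s_def V_def\<close>)
  then have "(\<Sum>y\<in>S. d y) - s * (s / Q) \<le> s * sqrt V * ((Q - 1) / Q)"
    by (simp add: sum_subtractf s_def)
  then show ?thesis unfolding N V_def by (simp add: power2_eq_square)
qed

section \<open>Combining the two bounds\<close>

theorem theorem2p3:
  fixes A :: "'a::{field,finite}^'n^'n"
    and S :: "('a^'n) set"
    and q n k :: nat
  assumes "q = CARD('a)" and "odd q"
    and "n = CARD('n)"
    and "k \<ge> 2" and "k \<le> q"
    and "symmetric_matrix A" and "nondegenerate_matrix A"
    and "k2_orthogonal (matrix_form A) k S"
  shows "real (card S) \<le>
    (real k - 1 + (real k - 1)^2 / (real q - real k + 1)) * (real q powr (real n / 2) + 1)"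
proof -
  define s where "s = real (card S)"
  define R where "R = real q powr (real n / 2)"
  define K where "K = real k - 1"
  define Q where "Q = real q"
  \<comment> \<open>\<open>Q - K\<close> is the denominator \<open>q - k + 1\<close>, positive
    because \<open>k \<le> q\<close>.\<close>
  have pos: "K > 0" "Q - K > 0" "Q > 0" "R \<ge> 0"
    using assms(4,5) by (auto simp: K_def Q_def R_def)
  have S0: "0 \<notin> S" using assms(8) by (auto simp: k2_orthogonal_def)
  \<comment> \<open>Turan's bound wants a reflexive relation, while a vector need not be isotropic.
    Adding the diagonal costs at most \<open>card S\<close> pairs, the extra summand below.\<close>
  define orth where "orth x y \<longleftrightarrow> x = y \<or> matrix_form A x y = 0" for x y
  have clique: "card T \<le> k - 1" if T: "T \<subseteq> S" "pairwise (\<lambda>x y. \<not> orth x y) T" for T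
  proof (rule ccontr)
    assume "\<not> card T \<le> k - 1"
    \<comment> \<open>A clique may have more than \<open>k\<close> vectors, whereas
      \<open>k2_orthogonal\<close> speaks of exactly \<open>k\<close>; hence the passage to a subset
      \<open>U\<close>.\<close>
    then have "k \<le> card T" by simp
    then obtain U where U: "U \<subseteq> T" "card U = k" "finite U"
      by (rule obtain_subset_with_card_n)
    then obtain v w where "v \<in> U" "w \<in> U" "v \<noteq> w" "matrix_form A v w = 0"
      using assms(8) order.trans[OF U(1) T(1)]
      unfolding k2_orthogonal_def mutually_orthogonal_def by blast
    with U(1) T(2) show False by (auto simp: pairwise_def orth_def)
  qed
  have "(card S)\<^sup>2 \<le> (k - 1) * card {(x, y) \<in> S \<times> S. orth x y}"
    by (rule turan_bound)
       (use clique matrix_form_commute[OF assms(6)] in \<open>auto simp: orth_def\<close>)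
  also have "card {(x, y) \<in> S \<times> S. orth x y}
      \<le> card ({(x, y) \<in> S \<times> S. matrix_form A x y = 0} \<union> (\<lambda>x. (x, x)) ` S)"
    by (intro card_mono) (auto simp: orth_def)
  also have "\<dots> \<le> card {(x, y) \<in> S \<times> S. matrix_form A x y = 0} + card S"
    by (rule order.trans[OF card_Un_le]) (auto intro: card_image_le)
  finally have "(card S)\<^sup>2 \<le> (k - 1) * (card {(x, y) \<in> S \<times> S. matrix_form A x y = 0} + card S)"
    by simp
  then have "real ((card S)\<^sup>2)
      \<le> real ((k - 1) * (card {(x, y) \<in> S \<times> S. matrix_form A x y = 0} + card S))"
    by (rule of_nat_mono)
  then have "s\<^sup>2 \<le> K * (real (card {(x, y) \<in> S \<times> S. matrix_form A x y = 0}) + s)"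
    using assms(4) by (simp add: s_def K_def of_nat_diff)
  also have "\<dots> \<le> K * (s\<^sup>2 / Q + s * R * ((Q - 1) / Q) + s)"
  proof -
    \<comment> \<open>The space has \<open>q ^ n\<close> vectors, so the square root is
      \<open>q\<close> to the power \<open>n / 2\<close>.\<close>
    have "sqrt (real CARD('a^'n)) = R"
      using assms(1,3) pos by (simp add: R_def Q_def powr_half_sqrt[symmetric] powr_powr
          flip: powr_realpow)
    then show ?thesis
      using card_orthogonal_pairs_le[OF assms(7) S0] pos assms(1)
      by (intro mult_left_mono) (auto simp: s_def Q_def)
  qed
  also have "\<dots> \<le> K * (s\<^sup>2 / Q + s * R + s)"
  proof -
    have "s * R * ((Q - 1) / Q) \<le> s * R * 1"
      using pos by (intro mult_left_mono) (auto simp: s_def)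
    then show ?thesis using pos by simp
  qed
  finally have *: "s\<^sup>2 \<le> K * (s\<^sup>2 / Q + s * R + s)" .
  have "s \<le> K * Q * (R + 1) / (Q - K)"
  proof (cases "s = 0")
    case True
    then show ?thesis using pos by simp
  next
    case False
    then have "s > 0" using of_nat_0_le_iff[of "card S"] unfolding s_def by linarith
    \<comment> \<open>Multiply \<open>*\<close> by \<open>Q\<close> and move
      \<open>K * s\<^sup>2\<close> to the left; one factor \<open>s\<close> then cancels.\<close>
    have "s * (s * (Q - K)) \<le> s * (K * Q * (R + 1))"
      using * pos by (simp add: field_simps power2_eq_square)
    then have "s * (Q - K) \<le> K * Q * (R + 1)" using \<open>s > 0\<close> by simp
    then show ?thesis using pos by (simp add: pos_le_divide_eq)
  qed
  \<comment> \<open>Writing \<open>Q = (Q - K) + K\<close> in the numerator splits the fraction into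
    the stated form.\<close>
  also have "\<dots> = (K + K\<^sup>2 / (Q - K)) * (R + 1)"
    using pos by (simp add: field_simps power2_eq_square)
  finally show ?thesis by (simp add: s_def K_def Q_def R_def algebra_simps)
qed

end
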